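(* Let $n\ge2$, $1\le d\le n$, $\epsilon\in\{+,-\}$ with $(d,\epsilon)\ne(n,-)$, and $\delta\in\{0,1\}$. The minimum distance $D$ of $\Gamma(n,d,\epsilon,\delta)$ is $D=2^{2n-d-2}$ if $\epsilon=+$ and $d<n$; $D=2^{n-1}$ if $\epsilon=+$ and $d=n$; and $D=2^{n-2}(2^{n-d}-1)$ if $\epsilon=-$.
   Context: Let $V=\mathbb{F}_2^{2n}$ with a symplectic form $B$. $\mathcal{Q}^\epsilon$ is the set of quadratic forms $\phi:V\to\mathbb{F}_2$ of type $\epsilon$ with $\phi(x+y)+\phi(x)+\phi(y)=B(x,y)$; signs are $\pm1$ in arithmetic. $\mathrm{Sing}(\phi)=\{x:\phi(x)=0\}$; $U$ totally isotropic means $B(U,U)=0$. $J(\mathcal V,k)$ is the Johnson graph (vertices $k$-subsets of $\mathcal V$, adjacent iff they meet in $k-1$ points); the minimum distance of a code is the minimum over distinct codewords of $k-|\Delta_1\cap\Delta_2|$. $\Gamma(n,d,\epsilon,\delta)$ is the code in $J(\mathcal{Q}^\epsilon,k)$, $k=2^{n-1}(2^{n-d}+\epsilon)$ for $\delta=0$ and $k=2^{2n-d-1}(2^d-1)$ for $\delta=1$, consisting of $\Delta^\delta(U)=\{\phi\in\mathcal{Q}^\epsilon:\dim(\mathrm{Sing}(\phi)\cap U)=d-\delta\}$ for all totally isotropic $d$-dimensional $U$. *)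

theory Defs
  imports "HOL-Analysis.Analysis" "HOL-Library.Z2"
begin

text \<open>The field of two elements is \<open>bit\<close>, and \<open>V\<close> is \<open>bit ^ 'm\<close> with \<open>CARD('m) = 2 * n\<close>.\<close>

definition bilinear_form :: "(bit ^ 'm::finite \<Rightarrow> bit ^ 'm \<Rightarrow> bit) \<Rightarrow> bool" where
  "bilinear_form B \<longleftrightarrow>
     (\<forall>x. Vector_Spaces.linear (*s) (*) (\<lambda>y. B x y)) \<and>
     (\<forall>y. Vector_Spaces.linear (*s) (*) (\<lambda>x. B x y))"

definition symplectic_form :: "(bit ^ 'm::finite \<Rightarrow> bit ^ 'm \<Rightarrow> bit) \<Rightarrow> bool" where
  "symplectic_form B \<longleftrightarrow>
     bilinear_form B \<and> (\<forall>x. B x x = 0) \<and> (\<forall>x. (\<forall>y. B x y = 0) \<longrightarrow> x = 0)"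

definition polar_form :: "(bit ^ 'm::finite \<Rightarrow> bit) \<Rightarrow> bit ^ 'm \<Rightarrow> bit ^ 'm \<Rightarrow> bit" where
  "polar_form \<phi> x y = \<phi> (x + y) + \<phi> x + \<phi> y"

definition quadratic_form :: "(bit ^ 'm::finite \<Rightarrow> bit) \<Rightarrow> bool" where
  "quadratic_form \<phi> \<longleftrightarrow>
     (\<forall>c x. \<phi> (c *s x) = c ^ 2 * \<phi> x) \<and> bilinear_form (polar_form \<phi>)"

definition Sing :: "(bit ^ 'm::finite \<Rightarrow> bit) \<Rightarrow> (bit ^ 'm) set" where
  "Sing \<phi> = {x. \<phi> x = 0}"

definition witt_index :: "(bit ^ 'm::finite \<Rightarrow> bit) \<Rightarrow> nat" where
  "witt_index \<phi> = Max {vec.dim W | W. vec.subspace W \<and> W \<subseteq> Sing \<phi>}"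

text \<open>Type of a quadratic form with nondegenerate polar form in dimension \<open>2 * n\<close>:
  the maximal totally singular subspaces have dimension \<open>n\<close> for type \<open>+\<close>
  and \<open>n - 1\<close> for type \<open>-\<close>.  The signs are the integers \<open>1\<close> and \<open>-1\<close>.\<close>

definition has_type :: "nat \<Rightarrow> int \<Rightarrow> (bit ^ 'm::finite \<Rightarrow> bit) \<Rightarrow> bool" where
  "has_type n eps \<phi> \<longleftrightarrow>
     (eps = 1 \<and> witt_index \<phi> = n) \<or> (eps = -1 \<and> witt_index \<phi> = n - 1)"

definition quad_forms ::
    "(bit ^ 'm::finite \<Rightarrow> bit ^ 'm \<Rightarrow> bit) \<Rightarrow> nat \<Rightarrow> int \<Rightarrow> (bit ^ 'm \<Rightarrow> bit) set" where
  "quad_forms B n eps =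
     {\<phi>. quadratic_form \<phi> \<and> (\<forall>x y. \<phi> (x + y) + \<phi> x + \<phi> y = B x y) \<and> has_type n eps \<phi>}"

definition totally_isotropic ::
    "(bit ^ 'm::finite \<Rightarrow> bit ^ 'm \<Rightarrow> bit) \<Rightarrow> (bit ^ 'm) set \<Rightarrow> bool" where
  "totally_isotropic B U \<longleftrightarrow> (\<forall>x\<in>U. \<forall>y\<in>U. B x y = 0)"

text \<open>\<open>Sing \<phi> \<inter> U\<close> is a subspace whenever \<open>U\<close> is totally isotropic, since then the
  restriction of \<open>\<phi>\<close> to \<open>U\<close> is additive; so \<open>vec.dim\<close> below is a dimension in the
  usual sense.\<close>

definition Delta_set ::
    "(bit ^ 'm::finite \<Rightarrow> bit ^ 'm \<Rightarrow> bit) \<Rightarrow> nat \<Rightarrow> nat \<Rightarrow> int \<Rightarrow> nat \<Rightarrow>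
     (bit ^ 'm) set \<Rightarrow> (bit ^ 'm \<Rightarrow> bit) set" where
  "Delta_set B n d eps delta U =
     {\<phi> \<in> quad_forms B n eps. vec.dim (Sing \<phi> \<inter> U) = d - delta}"

definition Gamma_code ::
    "(bit ^ 'm::finite \<Rightarrow> bit ^ 'm \<Rightarrow> bit) \<Rightarrow> nat \<Rightarrow> nat \<Rightarrow> int \<Rightarrow> nat \<Rightarrow>
     (bit ^ 'm \<Rightarrow> bit) set set" where
  "Gamma_code B n d eps delta =
     {Delta_set B n d eps delta U | U.
        vec.subspace U \<and> vec.dim U = d \<and> totally_isotropic B U}"

definition Gamma_k :: "nat \<Rightarrow> nat \<Rightarrow> int \<Rightarrow> nat \<Rightarrow> int" where
  "Gamma_k n d eps delta =
     (if delta = 0 then 2 ^ (n - 1) * (2 ^ (n - d) + eps)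
      else 2 ^ (2 * n - d - 1) * (2 ^ d - 1))"

text \<open>Minimum distance of a code \<open>C\<close> of \<open>k\<close>-subsets in a Johnson graph.  It is taken in
  \<open>int\<close>, so that the difference is not truncated.\<close>

definition johnson_min_distance :: "int \<Rightarrow> 'a set set \<Rightarrow> int" where
  "johnson_min_distance k C =
     Min {k - int (card (\<Delta>1 \<inter> \<Delta>2)) | \<Delta>1 \<Delta>2. \<Delta>1 \<in> C \<and> \<Delta>2 \<in> C \<and> \<Delta>1 \<noteq> \<Delta>2}"

end

theory Submission
  imports Defs
begin

text \<open>For isotropic \<open>U\<close> a form \<open>\<phi>\<close> is additive on \<open>U\<close>, so \<open>Delta_set\<close> for \<open>\<delta> = 0\<close> consists of the
  forms vanishing on \<open>U\<close>, and \<open>\<delta> = 1\<close> gives its complement; distances agree for both.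
  The type of a form is the sign of its Gauss sum \<open>\<Sum>x. (-1)^\<phi>(x) = \<plusminus>2^n\<close>. The forms vanishing on
  \<open>U1\<close> and \<open>U2\<close> are the translates of one of them by \<open>B a\<close> with \<open>a \<in> (U1 + U2)\<^sup>\<bottom>\<close>, and averaging
  Gauss sums over this family shows that
  \<open>2^(2n-d-i-1) + \<epsilon> 2^(n-r-1)\<close> of them have type \<open>\<epsilon>\<close>, where \<open>i = d - dim (U1 \<inter> U2)\<close> and
  \<open>r \<le> i\<close> is the rank of \<open>B\<close> on \<open>U1 \<times> U2\<close>. The distance is therefore smallest for \<open>i = 1\<close>, with
  \<open>r = 0\<close> if \<open>\<epsilon> = +\<close> and \<open>d < n\<close>, and \<open>r = 1\<close> otherwise.\<close>

text \<open>Keeps field operations in ring notation, so that \<open>ac_simps\<close> and additivity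
  rules apply to them.\<close>

declare add_bit_eq_xor [simp del] mult_bit_eq_and [simp del]

section \<open>Vector spaces over the field of two elements\<close>

lemma UNIV_bit: "(UNIV :: bit set) = {0, 1}"
proof -
  have "b \<in> {0, 1}" for b :: bit
    by (cases b) auto
  then show ?thesis
    by blast
qed

text \<open>Makes \<open>bit ^ 'm\<close>, and with it the type of all forms on it, finite, so the
  sums and cardinalities below need no finiteness side conditions.\<close>

instance bit :: finite
  by standard (simp add: UNIV_bit)

lemma card_UNIV_bit: "CARD(bit) = 2"
  by (simp add: UNIV_bit)

lemma bit_add_self [simp]: "(a::bit) + a = 0"
  by (cases a) (auto simp: add_bit_eq_xor)

lemma bit_add_self_left [simp]: "(a::bit) + (a + b) = b"
  by (simp flip: add.assoc)

lemma bit_add_eq_0_iff: "(a::bit) + b = 0 \<longleftrightarrow> a = b"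
  by (metis add.right_neutral bit_add_self_left)

lemma vec_add_self [simp]: "(x :: bit ^ 'm::finite) + x = 0"
  by (simp add: vec_eq_iff)

lemma vec_add_self_left [simp]: "(x :: bit ^ 'm::finite) + (x + y) = y"
  by (simp flip: add.assoc)

lemma vec_two_mult [simp]: "2 * (x :: bit ^ 'm::finite) = 0"
  by (simp add: mult_2)

lemma vec_diff_eq_add: "(x :: bit ^ 'm::finite) - y = x + y"
  by (simp add: vec_eq_iff)

lemma vec_add_eq_0_iff: "(x :: bit ^ 'm::finite) + y = 0 \<longleftrightarrow> x = y"
  by (metis add.right_neutral vec_add_self_left)

lemma bit_scalar_mult: "c *s (x :: bit ^ 'm::finite) = (if c = 0 then 0 else x)"
  by (cases c) auto

lemma subspace_bit_iff:
  "vec.subspace (W :: (bit ^ 'm::finite) set) \<longleftrightarrow> 0 \<in> W \<and> (\<forall>x\<in>W. \<forall>y\<in>W. x + y \<in> W)"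
  by (auto simp: vec.subspace_def bit_scalar_mult)

lemma add_mem_subspace_iff:
  fixes W :: "(bit ^ 'm::finite) set"
  assumes "vec.subspace W" "x \<in> W"
  shows "x + y \<in> W \<longleftrightarrow> y \<in> W" "y + x \<in> W \<longleftrightarrow> y \<in> W"
  using assms unfolding subspace_bit_iff by (metis add.commute vec_add_self_left)+

lemma sum_translate_subspace:
  fixes W :: "(bit ^ 'm::finite) set"
  assumes "vec.subspace W" "a \<in> W"
  shows "(\<Sum>x\<in>W. f (x + a)) = (\<Sum>x\<in>W. f x)"
  by (rule sum.reindex_bij_witness[where i = "\<lambda>x. x + a" and j = "\<lambda>x. x + a"])
     (use assms in \<open>auto simp: add_mem_subspace_iff add.assoc\<close>)

text \<open>For a subspace \<open>W\<close> this is the span of \<open>W\<close> and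
  \<open>v\<close>. The only scalars are 0 and 1, so two cosets suffice.\<close>

definition adjoin :: "(bit ^ 'm::finite) set \<Rightarrow> bit ^ 'm \<Rightarrow> (bit ^ 'm) set" where
  "adjoin W v = W \<union> (\<lambda>w. w + v) ` W"

lemma mem_adjoin_iff: "x \<in> adjoin W v \<longleftrightarrow> x \<in> W \<or> x + v \<in> W"
proof -
  have "x \<in> (\<lambda>w. w + v) ` W" if "x + v \<in> W"
    using image_eqI[of x "\<lambda>w. w + v" "x + v" W] that by (simp add: add.assoc)
  then show ?thesis
    by (auto simp: adjoin_def add.assoc)
qed

lemma subspace_adjoin:
  assumes "vec.subspace W"
  shows "vec.subspace (adjoin W v)"
  unfolding subspace_bit_iff
proof (intro conjI ballI)
  show "0 \<in> adjoin W v"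
    using assms by (simp add: mem_adjoin_iff subspace_bit_iff)
next
  fix x y assume "x \<in> adjoin W v" "y \<in> adjoin W v"
  then consider "x \<in> W" "y \<in> W" | "x + v \<in> W" "y \<in> W" | "x \<in> W" "y + v \<in> W"
    | "x + v \<in> W" "y + v \<in> W"
    by (auto simp: mem_adjoin_iff)
  then show "x + y \<in> adjoin W v"
  proof cases
    case 2
    then have "(x + v) + y \<in> W" using assms by (auto simp: subspace_bit_iff)
    then show ?thesis by (simp add: mem_adjoin_iff ac_simps)
  next
    case 3
    then have "x + (y + v) \<in> W" using assms by (auto simp: subspace_bit_iff)
    then show ?thesis by (simp add: mem_adjoin_iff ac_simps)
  next
    case 4
    then have "(x + v) + (y + v) \<in> W" using assms by (simp only: subspace_bit_iff)
    then show ?thesis by (simp add: mem_adjoin_iff ac_simps)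
  qed (use assms in \<open>auto simp: mem_adjoin_iff subspace_bit_iff\<close>)
qed

lemma card_adjoin:
  fixes W :: "(bit ^ 'm::finite) set"
  assumes "vec.subspace W" "v \<notin> W"
  shows "card (adjoin W v) = 2 * card W"
proof -
  have "W \<inter> (\<lambda>w. w + v) ` W = {}"
    using assms by (auto simp: add_mem_subspace_iff)
  then show ?thesis
    unfolding adjoin_def by (simp add: card_Un_disjoint card_image)
qed

lemma span_insert_eq_adjoin: "vec.span (insert v S) = adjoin (vec.span S) v"
  for v :: "bit ^ 'm::finite"
proof (intro equalityI subsetI)
  fix x assume "x \<in> vec.span (insert v S)"
  then obtain c where c: "x - c *s v \<in> vec.span S"
    by (auto simp: vec.span_insert)
  then show "x \<in> adjoin (vec.span S) v"
    by (cases c) (auto simp: mem_adjoin_iff vec_diff_eq_add)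
next
  fix x assume "x \<in> adjoin (vec.span S) v"
  then have "x - 0 *s v \<in> vec.span S \<or> x - 1 *s v \<in> vec.span S"
    by (simp add: mem_adjoin_iff vec_diff_eq_add)
  then show "x \<in> vec.span (insert v S)"
    unfolding vec.span_insert by blast
qed

lemma card_span_independent:
  fixes S :: "(bit ^ 'm::finite) set"
  assumes "vec.independent S"
  shows "card (vec.span S) = 2 ^ card S"
  using finite[of S] assms
proof (induction S rule: finite_induct)
  case (insert v S)
  then have "v \<notin> vec.span S" "vec.independent S"
    by (auto simp: vec.independent_insert)
  with insert show ?case
    by (simp add: span_insert_eq_adjoin card_adjoin)
qed simp

text \<open>Allows dimensions to be computed by counting, which is how the duality and intersection
  arguments below proceed.\<close>

lemma card_subspace:
  fixes W :: "(bit ^ 'm::finite) set"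
  assumes "vec.subspace W"
  shows "card W = 2 ^ vec.dim W"
proof -
  obtain S where "S \<subseteq> W" "vec.independent S" "W \<subseteq> vec.span S" "card S = vec.dim W"
    using vec.basis_exists by blast
  moreover from this have "vec.span S = W"
    using assms by (simp add: vec.span_subspace)
  ultimately show ?thesis
    using card_span_independent by metis
qed

text \<open>If \<open>z = a + b\<close> is one decomposition, the others are
  \<open>(a + t) + (b + t)\<close> with \<open>t\<close> in \<open>U1 \<inter> U2\<close>, so all
  fibres of addition have the same size. With \<open>g = 1\<close> this is the dimension formula for
  a sum of subspaces.\<close>

lemma sum_over_subspace_pairs:
  fixes U1 U2 :: "(bit ^ 'm::finite) set" and g :: "bit ^ 'm \<Rightarrow> int"
  assumes "vec.subspace U1" "vec.subspace U2"
  shows "(\<Sum>x\<in>U1. \<Sum>y\<in>U2. g (x + y)) = int (card (U1 \<inter> U2)) * (\<Sum>z\<in>{x + y | x y. x \<in> U1 \<and> y \<in> U2}. g z)"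
proof -
  let ?W = "{x + y | x y. x \<in> U1 \<and> y \<in> U2}"
  let ?F = "\<lambda>z. {p \<in> U1 \<times> U2. fst p + snd p = z}"
  have fibre: "card (?F z) = card (U1 \<inter> U2)" if "z \<in> ?W" for z
  proof -
    from that obtain a b where ab: "a \<in> U1" "b \<in> U2" "z = a + b" by auto
    have "bij_betw (\<lambda>t. (a + t, b + t)) (U1 \<inter> U2) (?F z)"
    proof (rule bij_betw_byWitness[where f' = "\<lambda>p. a + fst p"])
      have swap: "a + x = b + y" if "x + y = z" for x y
        using ab(3) that by (metis add.commute add.left_commute vec_add_self_left)
      show "\<forall>p\<in>?F z. (a + (a + fst p), b + (a + fst p)) = p"
        using swap by auto
      show "(\<lambda>p. a + fst p) ` ?F z \<subseteq> U1 \<inter> U2"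
      proof (intro subsetI, elim imageE)
        fix t p assume p: "p \<in> ?F z" "t = a + fst p"
        then have "t = b + snd p" "fst p \<in> U1" "snd p \<in> U2"
          using swap by auto
        then have "t \<in> U2"
          using assms ab by (simp only: add_mem_subspace_iff)
        moreover have "t \<in> U1"
          using p \<open>fst p \<in> U1\<close> assms ab by (simp only: add_mem_subspace_iff)
        ultimately show "t \<in> U1 \<inter> U2" by simp
      qed
    qed (use assms ab in \<open>auto simp: add_mem_subspace_iff ac_simps\<close>)
    then show ?thesis
      by (simp add: bij_betw_same_card)
  qed
  have "(\<Sum>x\<in>U1. \<Sum>y\<in>U2. g (x + y)) = (\<Sum>p\<in>U1 \<times> U2. g (fst p + snd p))"
    by (simp add: sum.cartesian_product case_prod_beta)
  also have "\<dots> = (\<Sum>z\<in>?W. \<Sum>p\<in>?F z. g (fst p + snd p))"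
    by (rule sum.group[symmetric]) (auto, blast)
  also have "\<dots> = (\<Sum>z\<in>?W. \<Sum>p\<in>?F z. g z)"
    by (intro sum.cong) auto
  also have "\<dots> = (\<Sum>z\<in>?W. int (card (U1 \<inter> U2)) * g z)"
    by (intro sum.cong) (simp_all only: sum_constant fibre)
  finally show ?thesis
    by (simp add: sum_distrib_left)
qed

section \<open>Character sums\<close>

definition chi :: "bit \<Rightarrow> int" where
  "chi b = (if b = 0 then 1 else -1)"

lemma chi_0 [simp]: "chi 0 = 1" and chi_1 [simp]: "chi 1 = -1"
  by (simp_all add: chi_def)

lemma chi_add: "chi (a + b) = chi a * chi b"
  by (cases a; cases b) simp_all

lemma chi_mult_self [simp]: "chi a * chi a = 1"
  by (cases a) simp_all

text \<open>If \<open>f a = 1\<close> for some \<open>a\<close>, translation by \<open>a\<close>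
  flips the sign of every term, so the sum equals its own negative.\<close>

lemma sum_chi_additive:
  fixes W :: "(bit ^ 'm::finite) set"
  assumes "vec.subspace W" and add: "\<And>x y. x \<in> W \<Longrightarrow> y \<in> W \<Longrightarrow> f (x + y) = f x + f y"
  shows "(\<Sum>x\<in>W. chi (f x)) = (if \<forall>x\<in>W. f x = 0 then int (card W) else 0)"
proof (cases "\<forall>x\<in>W. f x = 0")
  case False
  then obtain a where a: "a \<in> W" "f a = 1" by auto
  have "(\<Sum>x\<in>W. chi (f x)) = (\<Sum>x\<in>W. chi (f (x + a)))"
    using sum_translate_subspace[OF assms(1) a(1), of "\<lambda>x. chi (f x)"] by simp
  also have "\<dots> = (\<Sum>x\<in>W. - chi (f x))"
    using a by (intro sum.cong) (auto simp: add chi_add)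
  finally show ?thesis
    using False by (simp only: sum_negf if_False)
qed simp


section \<open>Quadratic forms with a given symplectic polarisation\<close>

locale symplectic_space =
  fixes B :: "bit ^ 'm::finite \<Rightarrow> bit ^ 'm \<Rightarrow> bit" and n :: nat
  assumes symplectic: "symplectic_form B" and card_index: "CARD('m) = 2 * n"
begin

lemma n_pos: "n > 0"
  using card_index zero_less_card_finite[where 'a = 'm] by linarith

lemma card_space: "CARD(bit ^ 'm) = 2 ^ (2 * n)"
  by (simp add: card_UNIV_bit card_index)

lemma B_add_left: "B (x + y) z = B x z + B y z"
  and B_add_right: "B x (y + z) = B x y + B x z"
  using symplectic by (simp_all add: symplectic_form_def bilinear_form_def Vector_Spaces.linear_iff)

lemma B_self [simp]: "B x x = 0"
  using symplectic by (simp add: symplectic_form_def)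

lemma B_zero_left [simp]: "B 0 x = 0"
  using B_add_left[of 0 0 x] by simp

lemma B_zero_right [simp]: "B x 0 = 0"
  using B_add_right[of x 0 0] by simp

lemma B_commute: "B x y = B y x"
proof -
  have "B (x + y) (x + y) = B x y + B y x"
    unfolding B_add_left B_add_right by simp
  then show ?thesis
    using bit_add_eq_0_iff by (metis B_self)
qed

lemma B_nondegenerate: "(\<forall>y. B x y = 0) \<longleftrightarrow> x = 0"
  using symplectic by (auto simp: symplectic_form_def)

definition perp :: "(bit ^ 'm) set \<Rightarrow> (bit ^ 'm) set" where
  "perp W = {x. \<forall>w\<in>W. B w x = 0}"

lemma subspace_perp: "vec.subspace (perp W)"
  by (auto simp: subspace_bit_iff perp_def B_add_right)

lemma sum_chi_B:
  assumes "vec.subspace W"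
  shows "(\<Sum>w\<in>W. chi (B w x)) = (if x \<in> perp W then int (card W) else 0)"
  using sum_chi_additive[OF assms, of "\<lambda>w. B w x"] by (simp add: B_add_left perp_def)

lemma sum_chi_B_UNIV: "(\<Sum>x\<in>UNIV. chi (B w x)) = (if w = 0 then 2 ^ (2 * n) else 0)"
proof -
  have "w \<in> perp UNIV \<longleftrightarrow> w = 0"
    using B_nondegenerate[of w] by (simp add: perp_def B_commute)
  then show ?thesis
    using sum_chi_B[of UNIV w] card_space by (simp add: B_commute del: CARD_vec)
qed

text \<open>Double counting: in the sum of \<open>chi (B w x)\<close> over \<open>W\<close> and the
  whole space, summing over \<open>x\<close> first leaves only \<open>w = 0\<close>, while summing
  over \<open>w\<close> first leaves only \<open>x\<close> in \<open>perp W\<close>.\<close>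

lemma card_perp:
  assumes "vec.subspace W"
  shows "card W * card (perp W) = 2 ^ (2 * n)"
proof -
  have "(\<Sum>w\<in>W. \<Sum>x\<in>UNIV. chi (B w x)) = (\<Sum>x\<in>UNIV. \<Sum>w\<in>W. chi (B w x))"
    by (rule sum.swap)
  moreover have "(\<Sum>w\<in>W. \<Sum>x\<in>UNIV. chi (B w x)) = 2 ^ (2 * n)"
    using assms by (simp add: sum_chi_B_UNIV sum.delta subspace_bit_iff)
  moreover have "(\<Sum>x\<in>UNIV. \<Sum>w\<in>W. chi (B w x)) = int (card W) * int (card (perp W))"
    using assms by (simp add: sum_chi_B sum.If_cases)
  ultimately have "int (card W * card (perp W)) = int (2 ^ (2 * n))"
    by simp
  then show ?thesis
    by (simp only: of_nat_eq_iff)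
qed

text \<open>\<open>W\<close> lies in its double complement, and two applications of
  \<open>card_perp\<close> show that both have the same size.\<close>

lemma perp_perp:
  assumes "vec.subspace W"
  shows "perp (perp W) = W"
proof -
  have "card W * card (perp W) = card (perp (perp W)) * card (perp W)"
    using card_perp[OF assms] card_perp[OF subspace_perp, of W] by (simp add: mult.commute)
  moreover have "card (perp W) \<noteq> 0"
    using card_perp[OF assms] by (metis mult_0_right power_not_zero zero_neq_numeral)
  ultimately have "card W = card (perp (perp W))"
    by simp
  moreover have "W \<subseteq> perp (perp W)"
    by (auto simp: perp_def B_commute)
  ultimately show ?thesis
    by (metis card_subset_eq finite)
qed

text \<open>The character sums of \<open>f + B a\<close>, added over all \<open>a\<close>, give a
  nonzero total because only \<open>x = 0\<close> survives. So one of these sums is nonzero, which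
  by \<open>sum_chi_additive\<close> forces \<open>f\<close> and \<open>B a\<close> to
  agree.\<close>

lemma additive_representable:
  assumes add: "\<And>x y. f (x + y) = f x + f y"
  obtains a where "\<And>x. f x = B a x"
proof -
  have f0: "f 0 = 0"
    using add[of 0 0] by simp
  have "(\<Sum>a\<in>UNIV. \<Sum>x\<in>UNIV. chi (f x + B a x)) = (\<Sum>x\<in>UNIV. chi (f x) * (\<Sum>a\<in>UNIV. chi (B x a)))"
    by (subst sum.swap) (simp add: chi_add sum_distrib_left B_commute)
  also have "\<dots> = (\<Sum>x\<in>UNIV. if x = 0 then chi (f x) * 2 ^ (2 * n) else 0)"
    by (intro sum.cong) (simp_all add: sum_chi_B_UNIV)
  also have "\<dots> = 2 ^ (2 * n)"
    by (simp add: f0)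
  finally have "(\<Sum>a\<in>UNIV. \<Sum>x\<in>UNIV. chi (f x + B a x)) \<noteq> 0"
    by simp
  then obtain a where a: "(\<Sum>x\<in>UNIV. chi (f x + B a x)) \<noteq> 0"
    by (meson sum.neutral)
  have "(\<Sum>x\<in>UNIV. chi (f x + B a x)) = (if \<forall>x\<in>UNIV. f x + B a x = 0 then int CARD(bit ^ 'm) else 0)"
    by (rule sum_chi_additive) (auto simp: add B_add_right ac_simps)
  with a have "\<And>x. f x = B a x"
    by (metis UNIV_I bit_add_eq_0_iff)
  then show ?thesis
    by (rule that)
qed

section \<open>Forms that polarise to \<open>B\<close>\<close>

definition polarized :: "(bit ^ 'm \<Rightarrow> bit) \<Rightarrow> bool" where
  "polarized \<phi> \<longleftrightarrow> (\<forall>x y. \<phi> (x + y) + \<phi> x + \<phi> y = B x y)"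

lemma polarized_iff: "polarized \<phi> \<longleftrightarrow> (\<forall>x y. \<phi> (x + y) = \<phi> x + \<phi> y + B x y)"
proof -
  have "a + b + c = d \<longleftrightarrow> a = b + c + d" for a b c d :: bit
    by (cases a; cases b; cases c; cases d) simp_all
  then show ?thesis
    unfolding polarized_def by blast
qed

lemma polarized_add: "polarized \<phi> \<Longrightarrow> \<phi> (x + y) = \<phi> x + \<phi> y + B x y"
  by (simp add: polarized_iff)

lemma polarized_zero: "polarized \<phi> \<Longrightarrow> \<phi> 0 = 0"
  using polarized_add[of \<phi> 0 0] by simp

text \<open>With scalars 0 and 1, homogeneity reduces to \<open>\<phi> 0 = 0\<close>, which
  polarisation at 0 provides.\<close>

lemma polarized_quadratic: "polarized \<phi> \<Longrightarrow> quadratic_form \<phi>"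
proof -
  assume \<phi>: "polarized \<phi>"
  then have "polar_form \<phi> = B"
    by (auto simp: polar_form_def polarized_def fun_eq_iff)
  moreover have "\<phi> (c *s x) = c ^ 2 * \<phi> x" for c x
    using \<phi> by (cases c) (simp_all add: polarized_zero)
  ultimately show ?thesis
    using symplectic by (simp add: quadratic_form_def symplectic_form_def)
qed

section \<open>Gauss sums and their relation to the Witt index\<close>

definition gauss_sum :: "(bit ^ 'm \<Rightarrow> bit) \<Rightarrow> int" where
  "gauss_sum \<phi> = (\<Sum>x\<in>UNIV. chi (\<phi> x))"

text \<open>Average over translations by \<open>W\<close>: since \<phi> vanishes on
  \<open>W\<close>, moving \<open>x\<close> by \<open>w\<close> multiplies its term by
  \<open>chi (B w x)\<close>, and the sum of these factors over \<open>W\<close> is zero off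
  \<open>perp W\<close>.\<close>

lemma gauss_sum_perp:
  assumes \<phi>: "polarized \<phi>" and W: "vec.subspace W" "W \<subseteq> Sing \<phi>"
  shows "gauss_sum \<phi> = (\<Sum>x\<in>perp W. chi (\<phi> x))"
proof -
  have "int (card W) * gauss_sum \<phi> = (\<Sum>w\<in>W. \<Sum>x\<in>UNIV. chi (\<phi> (x + w)))"
    using sum_translate_subspace[of UNIV _ "\<lambda>x. chi (\<phi> x)"] by (simp add: gauss_sum_def)
  also have "\<dots> = (\<Sum>w\<in>W. \<Sum>x\<in>UNIV. chi (\<phi> x) * chi (B w x))"
    using W \<phi> by (intro sum.cong) (auto simp: polarized_add chi_add Sing_def B_commute)
  also have "\<dots> = (\<Sum>x\<in>UNIV. chi (\<phi> x) * (\<Sum>w\<in>W. chi (B w x)))"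
    by (subst sum.swap) (simp add: sum_distrib_left)
  also have "\<dots> = (\<Sum>x\<in>UNIV. if x \<in> perp W then int (card W) * chi (\<phi> x) else 0)"
    using W by (intro sum.cong) (simp_all add: sum_chi_B)
  also have "\<dots> = int (card W) * (\<Sum>x\<in>perp W. chi (\<phi> x))"
    by (simp add: sum.If_cases sum_distrib_left)
  finally show ?thesis
    using card_subspace[OF W(1)] by simp
qed

text \<open>Replacing \<open>y\<close> by \<open>y + x\<close> in the double sum cancels
  \<open>\<phi> x\<close> and leaves \<open>chi (\<phi> y) * chi (B y x)\<close>; summation over
  \<open>x\<close> then kills every \<open>y\<close> except 0.\<close>

lemma gauss_sum_square:
  assumes \<phi>: "polarized \<phi>"
  shows "gauss_sum \<phi> * gauss_sum \<phi> = 2 ^ (2 * n)"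
proof -
  have "gauss_sum \<phi> * gauss_sum \<phi> = (\<Sum>x\<in>UNIV. \<Sum>y\<in>UNIV. chi (\<phi> x) * chi (\<phi> y))"
    by (simp add: gauss_sum_def sum_product)
  also have "\<dots> = (\<Sum>x\<in>UNIV. \<Sum>y\<in>UNIV. chi (\<phi> x) * chi (\<phi> (y + x)))"
    using sum_translate_subspace[of UNIV _ "\<lambda>y. chi (\<phi> _) * chi (\<phi> y)"] by simp
  also have "\<dots> = (\<Sum>x\<in>UNIV. \<Sum>y\<in>UNIV. chi (\<phi> y) * chi (B y x))"
  proof (intro sum.cong refl)
    fix x y
    have "chi (\<phi> x) * chi (\<phi> (y + x)) = (chi (\<phi> x) * chi (\<phi> x)) * (chi (\<phi> y) * chi (B y x))"
      unfolding polarized_add[OF \<phi>] chi_add by algebra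
    then show "chi (\<phi> x) * chi (\<phi> (y + x)) = chi (\<phi> y) * chi (B y x)"
      by (simp only: chi_mult_self mult_1)
  qed
  also have "\<dots> = (\<Sum>y\<in>UNIV. chi (\<phi> y) * (\<Sum>x\<in>UNIV. chi (B y x)))"
    by (subst sum.swap) (simp add: sum_distrib_left)
  also have "\<dots> = (\<Sum>y\<in>UNIV. if y = 0 then 2 ^ (2 * n) * chi (\<phi> y) else 0)"
    by (intro sum.cong) (simp_all add: sum_chi_B_UNIV)
  also have "\<dots> = 2 ^ (2 * n)"
    by (simp add: polarized_zero[OF \<phi>])
  finally show ?thesis .
qed

lemma gauss_sum_cases:
  assumes \<phi>: "polarized \<phi>"
  shows "gauss_sum \<phi> = 2 ^ n \<or> gauss_sum \<phi> = - (2 ^ n)"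
proof -
  have "(gauss_sum \<phi>)\<^sup>2 = (2 ^ n)\<^sup>2"
    using gauss_sum_square[OF assms] by (simp add: power2_eq_square mult_2 power_add)
  then show ?thesis
    by (simp add: power2_eq_iff)
qed

lemma singular_isotropic:
  assumes "polarized \<phi>" "vec.subspace W" "W \<subseteq> Sing \<phi>"
  shows "W \<subseteq> perp W"
proof
  fix x assume x: "x \<in> W"
  have "B w x = 0" if "w \<in> W" for w
  proof -
    have "w + x \<in> W"
      using x that assms(2) by (simp add: subspace_bit_iff)
    then have "\<phi> (w + x) = 0" "\<phi> w = 0" "\<phi> x = 0"
      using x that assms(3) by (auto simp: Sing_def)
    then show ?thesis
      using polarized_add[OF assms(1), of w x] by simp
  qed
  then show "x \<in> perp W"
    by (simp add: perp_def)
qed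

lemma card_perp_eq:
  assumes "vec.subspace W" "card W = 2 ^ k" "k \<le> 2 * n"
  shows "card (perp W) = 2 ^ (2 * n - k)"
proof -
  have "2 ^ k * card (perp W) = 2 ^ k * 2 ^ (2 * n - k)"
    using card_perp[OF assms(1)] assms by (simp flip: power_add)
  then show ?thesis
    by simp
qed

lemma dim_le:
  assumes "vec.subspace (W :: (bit ^ 'm) set)"
  shows "vec.dim W \<le> 2 * n"
proof -
  have "card W \<le> CARD(bit ^ 'm)"
    by (rule card_mono) auto
  then have "(2::nat) ^ vec.dim W \<le> 2 ^ (2 * n)"
    unfolding card_subspace[OF assms] card_space .
  then show ?thesis
    by (rule power_le_imp_le_exp[rotated]) simp
qed

text \<open>Let \<open>W\<close> be totally singular of maximal dimension \<open>w\<close>. If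
  \<open>w = n\<close>, then \<open>perp W = W\<close> and the Gauss sum just counts
  \<open>W\<close>. Otherwise maximality makes \<phi> equal to 1 on \<open>perp W - W\<close>, so
  the Gauss sum is \<open>2 * a - p\<close> with \<open>a\<close> and \<open>p\<close> the sizes of
  \<open>W\<close> and \<open>perp W\<close>; its known square then determines
  \<open>w\<close>.\<close>

lemma witt_index_gauss_sum:
  assumes \<phi>: "polarized \<phi>"
  shows "witt_index \<phi> = n \<and> gauss_sum \<phi> = 2 ^ n \<or> witt_index \<phi> = n - 1 \<and> gauss_sum \<phi> = - (2 ^ n)"
proof -
  let ?D = "{vec.dim W | W. vec.subspace W \<and> W \<subseteq> Sing \<phi>}"
  have fin: "finite ?D"
    by simp
  have "vec.dim {0 :: bit ^ 'm} \<in> ?D"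
    using polarized_zero[OF \<phi>] by (intro CollectI exI[of _ "{0}"]) (simp add: subspace_bit_iff Sing_def)
  then have "witt_index \<phi> \<in> ?D"
    unfolding witt_index_def using Max_in[OF fin] by blast
  then obtain W where W: "vec.subspace W" "W \<subseteq> Sing \<phi>" "vec.dim W = witt_index \<phi>"
    by auto
  define w where "w = witt_index \<phi>"
  have card_W: "card W = 2 ^ w"
    using card_subspace[OF W(1)] W(3) w_def by simp
  have le: "W \<subseteq> perp W"
    using singular_isotropic \<phi> W by blast
  have w2: "w \<le> 2 * n"
    using dim_le[OF W(1)] W(3) w_def by simp
  have card_P: "card (perp W) = 2 ^ (2 * n - w)"
    using card_perp_eq[OF W(1) card_W w2] .
  have "(2::nat) ^ w \<le> 2 ^ (2 * n - w)"
    using card_mono[OF _ le] card_W card_P by simp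
  then have "w \<le> n"
    by simp
  have on_W: "(\<Sum>x\<in>W. chi (\<phi> x)) = 2 ^ w"
  proof -
    have "(\<Sum>x\<in>W. chi (\<phi> x)) = (\<Sum>x\<in>W. 1)"
      using W(2) by (intro sum.cong) (auto simp: Sing_def)
    then show ?thesis
      by (simp add: card_W)
  qed
  show ?thesis
  proof (cases "w = n")
    case True
    then have "perp W = W"
      using card_subset_eq[OF _ le] card_W card_P by simp
    then show ?thesis
      using gauss_sum_perp[OF \<phi> W(1,2)] on_W True w_def by simp
  next
    case False
    have one: "\<phi> x = 1" if "x \<in> perp W" "x \<notin> W" for x
    proof (rule ccontr)
      assume "\<phi> x \<noteq> 1"
      \<comment> \<open>A singular vector orthogonal to \<open>W\<close> would enlarge
        \<open>W\<close> to a bigger totally singular subspace.\<close>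
      then have "adjoin W x \<subseteq> Sing \<phi>"
        using that W(2) by (auto simp: adjoin_def Sing_def perp_def polarized_add[OF \<phi>])
      then have "vec.dim (adjoin W x) \<le> w"
        unfolding w_def witt_index_def using subspace_adjoin[OF W(1)] by (intro Max_ge[OF fin]) auto
      moreover have "2 ^ vec.dim (adjoin W x) = (2::nat) ^ Suc w"
        using card_subspace[OF subspace_adjoin[OF W(1)], of x] card_adjoin[OF W(1) that(2)] card_W by simp
      then have "vec.dim (adjoin W x) = Suc w"
        by (simp only: power_inject_exp one_less_numeral_iff semiring_norm)
      ultimately show False
        by simp
    qed
    define a p :: int where "a = 2 ^ w" and "p = 2 ^ (2 * n - w)"
    have ap: "a * p = 2 ^ (2 * n)"
      using w2 by (simp add: a_def p_def flip: power_add)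
    have "(\<Sum>x\<in>perp W. chi (\<phi> x)) = (\<Sum>x\<in>perp W - W. chi (\<phi> x)) + 2 ^ w"
      using sum.subset_diff[OF le, of "\<lambda>x. chi (\<phi> x)"] on_W by simp
    also have "(\<Sum>x\<in>perp W - W. chi (\<phi> x)) = (\<Sum>x\<in>perp W - W. -1)"
      by (intro sum.cong) (auto simp: one)
    also have "\<dots> = a - p"
      using card_mono[OF _ le] by (simp add: card_Diff_subset le card_W card_P a_def p_def of_nat_diff)
    finally have S: "gauss_sum \<phi> = 2 * a - p"
      using gauss_sum_perp[OF \<phi> W(1,2)] by (simp add: a_def)
    then have "(2 * a - p) * (2 * a - p) = a * p"
      using gauss_sum_square[OF \<phi>] ap by simp
    \<comment> \<open>The quadratic equation from the squared Gauss sum factors. The root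
      \<open>p = a\<close> means \<open>w = n\<close>, and \<open>p = 4 * a\<close> means
      \<open>w = n - 1\<close>.\<close>
    then have "(p - a) * (p - 4 * a) = 0"
      by (simp add: algebra_simps)
    moreover have "p \<noteq> a"
      using \<open>w \<le> n\<close> False by (simp add: a_def p_def)
    ultimately have "p = 4 * a"
      by simp
    then have "(2::int) ^ (2 * n - w) = 2 ^ (w + 2)"
      by (simp add: a_def p_def)
    then have "2 * n - w = w + 2"
      by (simp only: power_inject_exp one_less_numeral_iff semiring_norm)
    then have "w = n - 1"
      using \<open>w \<le> n\<close> by simp
    moreover have "gauss_sum \<phi> = - (2 ^ n)"
      using S \<open>p = 4 * a\<close> \<open>w = n - 1\<close> n_pos by (cases n) (auto simp: a_def)
    ultimately show ?thesis
      by (simp add: w_def)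
  qed
qed

text \<open>Replaces the Witt index by the sign of a sum, which can be averaged over families of
  forms. Positivity of \<open>n\<close> keeps the indices \<open>n\<close> and \<open>n - 1\<close>
  apart.\<close>

lemma mem_quad_forms_iff:
  assumes "eps \<in> {1, -1}"
  shows "\<phi> \<in> quad_forms B n eps \<longleftrightarrow> polarized \<phi> \<and> gauss_sum \<phi> = eps * 2 ^ n"
proof (cases "polarized \<phi>")
  case True
  have "(2::int) ^ n > 0" by simp
  with assms True witt_index_gauss_sum[OF True] polarized_quadratic[OF True] n_pos show ?thesis
    by (auto simp: quad_forms_def has_type_def polarized_def)
qed (auto simp: quad_forms_def polarized_def)

text \<open>Induction on the size of the complement of \<open>W\<close>, adjoining one vector at a
  time.\<close>

lemma polarized_extend:
  assumes "vec.subspace W" and "\<And>x y. x \<in> W \<Longrightarrow> y \<in> W \<Longrightarrow> f (x + y) = f x + f y + B x y"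
  shows "\<exists>\<phi>. polarized \<phi> \<and> (\<forall>x\<in>W. \<phi> x = f x)"
  using assms
proof (induction "card (- W)" arbitrary: W f rule: less_induct)
  case less
  show ?case
  proof (cases "W = UNIV")
    case True
    then show ?thesis
      using less.prems by (auto simp: polarized_iff)
  next
    case False
    then obtain v where v: "v \<notin> W" by auto
    note W = less.prems(1) and f = less.prems(2)
    \<comment> \<open>The new vector \<open>v\<close> is given the value 0; polarisation then
      dictates the values on the coset of \<open>v\<close>, as
      \<open>B (x + v) v = B x v\<close>.\<close>
    define g where "g x = (if x \<in> W then f x else f (x + v) + B x v)" for x
    have coset: "x \<notin> W" if "x + v \<in> W" for x
      using that v W by (metis add_mem_subspace_iff(1))
    have mixed: "g (x + y) = g x + g y + B x y" if x: "x \<in> W" and y: "y + v \<in> W" for x y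
    proof -
      have "x + y \<notin> W"
        using x coset[OF y] W by (simp add: add_mem_subspace_iff)
      then have "g (x + y) = f (x + (y + v)) + B (x + y) v"
        by (simp add: g_def ac_simps)
      also have "\<dots> = f x + f (y + v) + B x (y + v) + B (x + y) v"
        by (simp only: f[OF x y])
      also have "\<dots> = f x + (f (y + v) + B y v) + B x y"
        by (simp add: B_add_left B_add_right ac_simps)
      finally show ?thesis
        using x coset[OF y] by (simp add: g_def)
    qed
    have "g (x + y) = g x + g y + B x y" if xy: "x \<in> adjoin W v" "y \<in> adjoin W v" for x y
    proof -
      consider "x \<in> W" "y \<in> W" | "x \<in> W" "y + v \<in> W" | "y \<in> W" "x + v \<in> W" | "x + v \<in> W" "y + v \<in> W"
        using xy by (auto simp: mem_adjoin_iff)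
      then show ?thesis
      proof cases
        case 1
        then show ?thesis
          using W f by (simp add: g_def subspace_bit_iff)
      next
        case 2
        then show ?thesis by (rule mixed)
      next
        case 3
        then show ?thesis
          using mixed[of y x] by (simp add: ac_simps B_commute)
      next
        case 4
        have eq: "(x + v) + (y + v) = x + y"
          by (simp add: ac_simps)
        have "x + y \<in> W"
          using 4 W eq unfolding subspace_bit_iff by metis
        then have "g (x + y) = f ((x + v) + (y + v))"
          by (simp add: g_def eq)
        also have "\<dots> = f (x + v) + f (y + v) + B (x + v) (y + v)"
          by (rule f) fact+
        also have "\<dots> = g x + g y + B x y"
          using coset 4 by (simp add: g_def B_add_left B_add_right B_commute[of v y] ac_simps)
        finally show ?thesis .
      qed
    qed
    moreover have "- adjoin W v \<subset> - W"
      using v W by (auto simp: mem_adjoin_iff subspace_bit_iff)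
    then have "card (- adjoin W v) < card (- W)"
      by (simp add: psubset_card_mono)
    ultimately obtain \<phi> where \<phi>: "polarized \<phi>" "\<forall>x\<in>adjoin W v. \<phi> x = g x"
      using less.hyps[OF _ subspace_adjoin[OF W], of v g] by blast
    then have "\<forall>x\<in>W. \<phi> x = f x"
      by (simp add: mem_adjoin_iff g_def)
    with \<phi>(1) show ?thesis by blast
  qed
qed

section \<open>Counting forms that vanish on two isotropic subspaces\<close>

text \<open>A form vanishing on both subspaces must take the value \<open>B x y\<close> at
  \<open>x + y\<close>. Isotropy makes this well defined on \<open>U1 + U2\<close>, and
  \<open>polarized_extend\<close> carries it to the whole space.\<close>

lemma polarized_vanishing_exists:
  assumes U: "vec.subspace U1" "vec.subspace U2" "totally_isotropic B U1" "totally_isotropic B U2"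
  obtains \<phi> where "polarized \<phi>" "\<And>x. x \<in> U1 \<union> U2 \<Longrightarrow> \<phi> x = 0"
proof -
  let ?W = "{x + y | x y. x \<in> U1 \<and> y \<in> U2}"
  have iso: "B x y = 0" if "x \<in> U1 \<and> y \<in> U1 \<or> x \<in> U2 \<and> y \<in> U2" for x y
    using U that by (auto simp: totally_isotropic_def)
  have "\<forall>z\<in>?W. \<exists>p. fst p \<in> U1 \<and> snd p \<in> U2 \<and> z = fst p + snd p"
    by auto
  from bchoice[OF this] obtain p
    where p: "\<And>z. z \<in> ?W \<Longrightarrow> fst (p z) \<in> U1 \<and> snd (p z) \<in> U2 \<and> z = fst (p z) + snd (p z)"
    by blast
  define f where "f z = B (fst (p z)) (snd (p z))" for z
  have f: "f (x + y) = B x y" if xy: "x \<in> U1" "y \<in> U2" for x y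
  proof -
    obtain a b where ab: "a = fst (p (x + y))" "b = snd (p (x + y))" by simp
    have "x + y \<in> ?W" using xy by blast
    from p[OF this] have ab': "a \<in> U1" "b \<in> U2" "x + y = a + b"
      by (simp_all add: ab)
    \<comment> \<open>Two decompositions of the same vector differ by a common \<open>t\<close> in
      \<open>U1 \<inter> U2\<close>, so each correction term \<open>B x t\<close>,
      \<open>B t y\<close>, \<open>B t t\<close> pairs two vectors of one isotropic
      subspace.\<close>
    define t where "t = x + a"
    have "t = y + b"
      using ab'(3) unfolding t_def by (metis add.commute add.left_commute vec_add_self_left)
    moreover have "a = x + t"
      by (simp add: t_def)
    moreover have "t \<in> U1" "y + b \<in> U2"
      using xy ab' U by (simp_all add: t_def subspace_bit_iff)
    ultimately have "t \<in> U2" "b = y + t" by simp_all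
    then have "B a b = B x y + B x t + B t y + B t t"
      using \<open>a = x + t\<close> by (simp add: B_add_left B_add_right ac_simps)
    also have "\<dots> = B x y"
      using iso \<open>t \<in> U1\<close> \<open>t \<in> U2\<close> xy by simp
    finally show ?thesis
      by (simp add: f_def ab)
  qed
  have "\<exists>\<phi>. polarized \<phi> \<and> (\<forall>x\<in>?W. \<phi> x = f x)"
  proof (rule polarized_extend)
    show "vec.subspace ?W"
      using U by (intro vec.subspace_sums)
    fix z z' assume "z \<in> ?W" "z' \<in> ?W"
    then obtain x y x' y' where xy: "x \<in> U1" "y \<in> U2" "z = x + y" "x' \<in> U1" "y' \<in> U2" "z' = x' + y'"
      by blast
    have "f (z + z') = f ((x + x') + (y + y'))"
      using xy by (simp add: ac_simps)
    also have "\<dots> = B (x + x') (y + y')"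
      using xy U by (intro f) (auto simp: subspace_bit_iff)
    also have "\<dots> = B x y + B x' y' + (B x y' + B y x')"
      by (simp add: B_add_left B_add_right B_commute[of x' y] ac_simps)
    also have "B x y' + B y x' = B z z'"
      using iso xy by (simp add: B_add_left B_add_right)
    finally show "f (z + z') = f z + f z' + B z z'"
      using xy by (simp add: f)
  qed
  then obtain \<phi> where \<phi>: "polarized \<phi>" "\<And>z. z \<in> ?W \<Longrightarrow> \<phi> z = f z"
    by blast
  have "\<phi> x = 0" if "x \<in> U1 \<union> U2" for x
  proof -
    have zero: "0 \<in> U1" "0 \<in> U2"
      using U by (auto simp: subspace_bit_iff)
    from that show ?thesis
    proof
      assume x: "x \<in> U1"
      then have "x + 0 \<in> ?W" using zero by blast
      then show ?thesis using \<phi>(2)[of "x + 0"] f[OF x zero(2)] by simp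
    next
      assume x: "x \<in> U2"
      then have "0 + x \<in> ?W" using zero by blast
      then show ?thesis using \<phi>(2)[of "0 + x"] f[OF zero(1) x] by simp
    qed
  qed
  with \<phi>(1) show ?thesis
    by (rule that)
qed

lemma polarized_translate: "polarized \<phi> \<Longrightarrow> polarized (\<lambda>x. \<phi> x + B a x)"
  by (simp add: polarized_iff B_add_right ac_simps)

text \<open>The polarisations cancel in the sum of the two forms, which is therefore additive and
  represented by some \<open>B a\<close>.\<close>

lemma polarized_difference:
  assumes "polarized \<phi>" "polarized \<psi>"
  obtains a where "\<psi> = (\<lambda>x. \<phi> x + B a x)"
proof -
  obtain a where "\<And>x. \<phi> x + \<psi> x = B a x"
    by (rule additive_representable[of "\<lambda>x. \<phi> x + \<psi> x"])
       (use assms in \<open>auto simp: polarized_add ac_simps\<close>)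
  then have "\<psi> = (\<lambda>x. \<phi> x + B a x)"
    by (metis bit_add_self_left)
  then show ?thesis
    by (rule that)
qed

lemma inj_translate: "inj (\<lambda>a x. (\<phi> x :: bit) + B a x)"
proof (rule injI)
  fix a b assume "(\<lambda>x. \<phi> x + B a x) = (\<lambda>x. \<phi> x + B b x)"
  then have "B a x = B b x" for x
    by (metis bit_add_self_left)
  then have "\<forall>x. B (a + b) x = 0"
    by (simp add: B_add_left)
  then show "a = b"
    by (simp add: B_nondegenerate vec_add_eq_0_iff)
qed

text \<open>For an isotropic subspace this is the codeword with \<delta> = 0; for a union of two
  such subspaces it is the intersection of their codewords.\<close>

definition vanishing_forms :: "int \<Rightarrow> (bit ^ 'm) set \<Rightarrow> (bit ^ 'm \<Rightarrow> bit) set" where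
  "vanishing_forms eps U = {\<phi> \<in> quad_forms B n eps. \<forall>x\<in>U. \<phi> x = 0}"

text \<open>Here \<open>j\<close> and \<open>s\<close> are the dimensions of
  \<open>U1 \<inter> U2\<close> and \<open>perp U1 \<inter> U2\<close>, so \<open>i = d - j\<close>
  and \<open>r = d - s\<close>. The count is doubled because the halved exponent
  \<open>n - d + s - 1\<close> is negative when \<open>d = n\<close> and
  \<open>s = 0\<close>.\<close>

lemma card_vanishing_forms:
  assumes U: "vec.subspace U1" "vec.subspace U2" "totally_isotropic B U1" "totally_isotropic B U2"
    and eps: "eps \<in> {1, -1}"
    and cards: "card U1 = 2 ^ d" "card U2 = 2 ^ d" "d \<le> n"
      "card (U1 \<inter> U2) = 2 ^ j" "card (perp U1 \<inter> U2) = 2 ^ s"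
  shows "2 * int (card (vanishing_forms eps (U1 \<union> U2))) = 2 ^ (2 * n - 2 * d + j) + eps * 2 ^ (n - d + s)"
proof -
  let ?W = "{x + y | x y. x \<in> U1 \<and> y \<in> U2}"
  let ?A = "{\<phi>. polarized \<phi> \<and> (\<forall>x\<in>U1 \<union> U2. \<phi> x = 0)}"
  obtain \<phi> where \<phi>: "polarized \<phi>" "\<And>x. x \<in> U1 \<union> U2 \<Longrightarrow> \<phi> x = 0"
    using polarized_vanishing_exists[OF U] by blast
  let ?t = "\<lambda>a x. \<phi> x + B a x"
  have W: "vec.subspace ?W"
    using U by (intro vec.subspace_sums)
  have mem_perp_W: "a \<in> perp ?W \<longleftrightarrow> (\<forall>x\<in>U1 \<union> U2. B a x = 0)" for a
  proof
    assume a: "a \<in> perp ?W"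
    show "\<forall>x\<in>U1 \<union> U2. B a x = 0"
    proof
      fix x assume "x \<in> U1 \<union> U2"
      moreover have "0 \<in> U1" "0 \<in> U2"
        using U by (auto simp: subspace_bit_iff)
      ultimately have "x \<in> ?W"
        by (metis (mono_tags, lifting) Un_iff add.left_neutral add.right_neutral mem_Collect_eq)
      then show "B a x = 0"
        using a unfolding perp_def B_commute[of a x] by blast
    qed
  next
    assume "\<forall>x\<in>U1 \<union> U2. B a x = 0"
    then show "a \<in> perp ?W"
      by (auto simp: perp_def B_add_right B_commute[of _ a])
  qed
  have A: "?A = ?t ` perp ?W"
  proof (intro equalityI subsetI)
    fix \<psi> assume \<psi>: "\<psi> \<in> ?A"
    then obtain a where a: "\<psi> = ?t a"
      using polarized_difference[OF \<phi>(1)] by blast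
    have "B a x = 0" if "x \<in> U1 \<union> U2" for x
    proof -
      have "\<psi> x = 0"
        using \<psi> that by blast
      then show ?thesis
        using a \<phi>(2)[OF that] by simp
    qed
    then show "\<psi> \<in> ?t ` perp ?W"
      using a mem_perp_W by blast
  next
    fix \<psi> assume "\<psi> \<in> ?t ` perp ?W"
    then show "\<psi> \<in> ?A"
      using \<phi> mem_perp_W polarized_translate[OF \<phi>(1)] by auto
  qed
  have inj: "inj_on ?t (perp ?W)"
    using inj_translate inj_on_subset by blast
  have card_A: "card ?A = card (perp ?W)"
    unfolding A using inj by (rule card_image)
  \<comment> \<open>The size of \<open>U1 + U2\<close> gives that of its complement, hence the
    number of forms in the family.\<close>
  have "int (card U1) * int (card U2) = int (card (U1 \<inter> U2)) * int (card ?W)"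
    using sum_over_subspace_pairs[OF U(1,2), of "\<lambda>_. 1"] by simp
  then have "int (2 ^ d * 2 ^ d) = int (2 ^ j * card ?W)"
    unfolding cards by simp
  then have "2 ^ d * 2 ^ d = 2 ^ j * card ?W"
    by (simp only: of_nat_eq_iff)
  then have "2 ^ d * 2 ^ d * card (perp ?W) = 2 ^ j * (card ?W * card (perp ?W))"
    by (simp only: mult.assoc)
  also have "\<dots> = 2 ^ (2 * n) * 2 ^ j"
    by (simp only: card_perp[OF W] mult.commute)
  also have "\<dots> = 2 ^ d * 2 ^ d * 2 ^ (2 * n - 2 * d + j)"
    using cards(3) by (simp flip: power_add)
  finally have card_perp_W: "card (perp ?W) = 2 ^ (2 * n - 2 * d + j)"
    by simp
  have iso: "\<phi> (x + y) = B x y" if "x \<in> U1" "y \<in> U2" for x y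
    using that \<phi> by (simp add: polarized_add)
  \<comment> \<open>On \<open>U1 + U2\<close> the form is \<open>B x y\<close>, so for fixed
    \<open>y\<close> the sum over \<open>U1\<close> is a character sum that survives only for
    \<open>y\<close> in \<open>perp U1\<close>.\<close>
  have sum_W: "2 ^ j * (\<Sum>z\<in>?W. chi (\<phi> z)) = 2 ^ s * 2 ^ d"
  proof -
    have "2 ^ j * (\<Sum>z\<in>?W. chi (\<phi> z)) = (\<Sum>x\<in>U1. \<Sum>y\<in>U2. chi (\<phi> (x + y)))"
      using sum_over_subspace_pairs[OF U(1,2), of "\<lambda>z. chi (\<phi> z)"] cards(4) by simp
    also have "\<dots> = (\<Sum>x\<in>U1. \<Sum>y\<in>U2. chi (B x y))"
      by (intro sum.cong refl) (simp add: iso)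
    also have "\<dots> = (\<Sum>y\<in>U2. \<Sum>x\<in>U1. chi (B x y))"
      by (rule sum.swap)
    also have "\<dots> = (\<Sum>y\<in>U2. if y \<in> perp U1 then 2 ^ d else 0)"
      by (intro sum.cong refl) (simp add: sum_chi_B[OF U(1)] cards(1))
    also have "\<dots> = 2 ^ s * 2 ^ d"
      using cards(5) by (simp add: sum.If_cases Int_commute)
    finally show ?thesis .
  qed
  have "(\<Sum>\<psi>\<in>?A. gauss_sum \<psi>) = (\<Sum>a\<in>perp ?W. \<Sum>x\<in>UNIV. chi (\<phi> x) * chi (B a x))"
    unfolding A sum.reindex[OF inj] by (simp add: gauss_sum_def chi_add)
  also have "\<dots> = (\<Sum>x\<in>UNIV. chi (\<phi> x) * (\<Sum>a\<in>perp ?W. chi (B a x)))"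
    by (subst sum.swap) (simp add: sum_distrib_left)
  \<comment> \<open>The inner sum is supported on the double complement of \<open>U1 + U2\<close>,
    which is \<open>U1 + U2\<close> itself.\<close>
  also have "\<dots> = (\<Sum>x\<in>UNIV. if x \<in> ?W then int (card (perp ?W)) * chi (\<phi> x) else 0)"
    by (intro sum.cong refl) (simp only: sum_chi_B[OF subspace_perp] perp_perp[OF W] mult.commute
        mult_zero_right mult_zero_left if_distrib[of "\<lambda>c. _ * c"] cong: if_cong)
  also have "\<dots> = int (card (perp ?W)) * (\<Sum>x\<in>?W. chi (\<phi> x))"
    by (simp add: sum.If_cases sum_distrib_left)
  also have "\<dots> = 2 ^ (2 * n - 2 * d) * (2 ^ j * (\<Sum>x\<in>?W. chi (\<phi> x)))"
    by (simp add: card_perp_W power_add)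
  also have "\<dots> = 2 ^ (2 * n - 2 * d) * (2 ^ s * 2 ^ d)"
    by (simp only: sum_W)
  also have "\<dots> = 2 ^ (2 * n - 2 * d + d + s)"
    by (simp add: power_add)
  also have "2 * n - 2 * d + d + s = n + (n - d + s)"
    using cards(3) by simp
  finally have sum_gauss: "(\<Sum>\<psi>\<in>?A. gauss_sum \<psi>) = 2 ^ (n + (n - d + s))" .
  \<comment> \<open>As each Gauss sum is plus or minus \<open>2 ^ n\<close>, the summand is
    \<open>2 * 2 ^ n\<close> times the indicator of type \<open>eps\<close>.\<close>
  have "(\<Sum>\<psi>\<in>?A. 2 ^ n + eps * gauss_sum \<psi>) = (\<Sum>\<psi>\<in>?A. if gauss_sum \<psi> = eps * 2 ^ n then 2 * 2 ^ n else 0)"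
  proof (intro sum.cong refl)
    fix \<psi> assume "\<psi> \<in> ?A"
    then have "gauss_sum \<psi> = 2 ^ n \<or> gauss_sum \<psi> = - (2 ^ n)"
      using gauss_sum_cases by blast
    then show "2 ^ n + eps * gauss_sum \<psi> = (if gauss_sum \<psi> = eps * 2 ^ n then 2 * 2 ^ n else 0)"
      using eps by auto
  qed
  also have "\<dots> = 2 * 2 ^ n * int (card (?A \<inter> {\<psi>. gauss_sum \<psi> = eps * 2 ^ n}))"
    by (simp add: sum.If_cases)
  also have "?A \<inter> {\<psi>. gauss_sum \<psi> = eps * 2 ^ n} = vanishing_forms eps (U1 \<union> U2)"
    using mem_quad_forms_iff[OF eps] by (auto simp: vanishing_forms_def)
  finally have "2 * 2 ^ n * int (card (vanishing_forms eps (U1 \<union> U2)))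
      = (\<Sum>\<psi>\<in>?A. 2 ^ n + eps * gauss_sum \<psi>)" ..
  also have "\<dots> = 2 ^ n * int (card ?A) + eps * (\<Sum>\<psi>\<in>?A. gauss_sum \<psi>)"
    by (simp add: sum.distrib sum_distrib_left)
  also have "\<dots> = 2 ^ n * (2 ^ (2 * n - 2 * d + j) + eps * 2 ^ (n - d + s))"
    unfolding sum_gauss card_A card_perp_W by (simp add: power_add algebra_simps)
  finally show ?thesis
    by simp
qed

section \<open>Distances between codewords\<close>

lemma quad_forms_polarized: "\<phi> \<in> quad_forms B n eps \<Longrightarrow> polarized \<phi>"
  by (simp add: quad_forms_def polarized_def)

text \<open>On \<open>U\<close> the form is additive. If it is nonzero, its character sum vanishes,
  so zeros and nonzeros are equally many and the zeros form a hyperplane.\<close>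

lemma dim_singular_isotropic:
  assumes \<phi>: "polarized \<phi>" and U: "vec.subspace U" "totally_isotropic B U"
  shows "(\<forall>x\<in>U. \<phi> x = 0) \<Longrightarrow> vec.dim (Sing \<phi> \<inter> U) = vec.dim U"
    and "\<not> (\<forall>x\<in>U. \<phi> x = 0) \<Longrightarrow> Suc (vec.dim (Sing \<phi> \<inter> U)) = vec.dim U"
proof -
  let ?Z = "Sing \<phi> \<inter> U"
  assume "\<forall>x\<in>U. \<phi> x = 0"
  then have "?Z = U"
    by (auto simp: Sing_def)
  then show "vec.dim ?Z = vec.dim U"
    by simp
next
  let ?Z = "Sing \<phi> \<inter> U"
  assume nz: "\<not> (\<forall>x\<in>U. \<phi> x = 0)"
  have add: "\<phi> (x + y) = \<phi> x + \<phi> y" if "x \<in> U" "y \<in> U" for x y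
    using U(2) that by (simp add: polarized_add[OF \<phi>] totally_isotropic_def)
  have Z: "vec.subspace ?Z"
    using U(1) by (auto simp: subspace_bit_iff Sing_def add polarized_zero[OF \<phi>])
  have "(\<Sum>x\<in>U. chi (\<phi> x)) = 0"
    using sum_chi_additive[OF U(1) add] nz by simp
  moreover have "(\<Sum>x\<in>U. chi (\<phi> x)) = (\<Sum>x\<in>U - ?Z. chi (\<phi> x)) + (\<Sum>x\<in>?Z. chi (\<phi> x))"
    by (rule sum.subset_diff) auto
  moreover have "(\<Sum>x\<in>U - ?Z. chi (\<phi> x)) = (\<Sum>x\<in>U - ?Z. -1)"
    by (intro sum.cong refl) (auto simp: Sing_def)
  moreover have "(\<Sum>x\<in>?Z. chi (\<phi> x)) = (\<Sum>x\<in>?Z. 1)"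
    by (intro sum.cong refl) (auto simp: Sing_def)
  ultimately have "card (U - ?Z) = card ?Z"
    by simp
  moreover have "card U = card (U - ?Z) + card ?Z"
    using card_Diff_subset[of ?Z U] card_mono[of U ?Z] by simp
  ultimately have "(2::nat) ^ vec.dim U = 2 ^ Suc (vec.dim ?Z)"
    using card_subspace[OF U(1)] card_subspace[OF Z] by simp
  then show "Suc (vec.dim ?Z) = vec.dim U"
    by (simp only: power_inject_exp one_less_numeral_iff semiring_norm)
qed

lemma Delta_set_0:
  assumes "vec.subspace U" "totally_isotropic B U"
  shows "Delta_set B n (vec.dim U) eps 0 U = vanishing_forms eps U"
proof -
  have "vec.dim (Sing \<phi> \<inter> U) = vec.dim U \<longleftrightarrow> (\<forall>x\<in>U. \<phi> x = 0)" if "\<phi> \<in> quad_forms B n eps" for \<phi>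
    using dim_singular_isotropic[OF quad_forms_polarized[OF that] assms] by linarith
  then show ?thesis
    by (auto simp: Delta_set_def vanishing_forms_def)
qed

text \<open>The bound \<open>1 \<le> vec.dim U\<close> keeps the truncated difference
  \<open>vec.dim U - 1\<close> distinct from \<open>vec.dim U\<close>.\<close>

lemma Delta_set_1:
  assumes "vec.subspace U" "totally_isotropic B U" "1 \<le> vec.dim U"
  shows "Delta_set B n (vec.dim U) eps 1 U = quad_forms B n eps - vanishing_forms eps U"
proof -
  have "vec.dim (Sing \<phi> \<inter> U) = vec.dim U - 1 \<longleftrightarrow> \<not> (\<forall>x\<in>U. \<phi> x = 0)" if "\<phi> \<in> quad_forms B n eps" for \<phi>
    using dim_singular_isotropic[OF quad_forms_polarized[OF that] assms(1,2)] assms(3) by linarith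
  then show ?thesis
    by (auto simp: Delta_set_def vanishing_forms_def)
qed

text \<open>With \<open>X1\<close> and \<open>X2\<close> the sets of forms vanishing on
  \<open>U1\<close> and \<open>U2\<close>, the right side is twice
  \<open>card X1 - card (X1 \<inter> X2)\<close>. By inclusion-exclusion and
  \<open>card X1 = card X2\<close>, complements in \<open>quad_forms B n eps\<close> have the same
  distance.\<close>

lemma codeword_distance:
  assumes U: "vec.subspace U1" "vec.subspace U2" "totally_isotropic B U1" "totally_isotropic B U2"
    and eps: "eps \<in> {1, -1}" and delta: "delta \<in> {0, 1}"
    and dims: "vec.dim U1 = d" "vec.dim U2 = d" "1 \<le> d" "d \<le> n"
    and cards: "card (U1 \<inter> U2) = 2 ^ j" "card (perp U1 \<inter> U2) = 2 ^ s"
  shows "2 * (Gamma_k n d eps delta - int (card (Delta_set B n d eps delta U1 \<inter> Delta_set B n d eps delta U2)))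
    = 2 ^ (2 * n - d) + eps * 2 ^ n - (2 ^ (2 * n - 2 * d + j) + eps * 2 ^ (n - d + s))"
proof -
  have card_single: "2 * int (card (vanishing_forms eps U)) = 2 ^ (2 * n - e) + eps * 2 ^ n"
    if "vec.subspace U" "totally_isotropic B U" "vec.dim U = e" "e \<le> n" for U e
  proof -
    \<comment> \<open>A single codeword is counted as the degenerate pair \<open>U1 = U2\<close>,
      where \<open>j\<close> and \<open>s\<close> both equal the dimension.\<close>
    have "perp U \<inter> U = U"
      using that(2) by (auto simp: perp_def totally_isotropic_def)
    then show ?thesis
      using card_vanishing_forms[of U U eps e e e] that eps card_subspace[OF that(1)] by simp
  qed
  let ?Q = "quad_forms B n eps"
  let ?X1 = "vanishing_forms eps U1" and ?X2 = "vanishing_forms eps U2"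
  have X: "?X1 \<inter> ?X2 = vanishing_forms eps (U1 \<union> U2)"
    by (auto simp: vanishing_forms_def)
  have cX: "2 * int (card (?X1 \<inter> ?X2)) = 2 ^ (2 * n - 2 * d + j) + eps * 2 ^ (n - d + s)"
    unfolding X using U eps dims cards card_subspace[OF U(1)] card_subspace[OF U(2)]
    by (intro card_vanishing_forms) auto
  have pow: "(2::int) ^ n = 2 * 2 ^ (n - 1)"
    using n_pos by (simp flip: power_Suc)
  show ?thesis
  proof (cases "delta = 0")
    case True
    have "2 * Gamma_k n d eps delta = 2 ^ n * 2 ^ (n - d) + eps * 2 ^ n"
      using True by (simp add: Gamma_k_def pow algebra_simps)
    also have "(2::int) ^ n * 2 ^ (n - d) = 2 ^ (2 * n - d)"
      using dims(4) by (simp flip: power_add)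
    finally show ?thesis
      using Delta_set_0[OF U(1,3)] Delta_set_0[OF U(2,4)] cX True by (simp add: dims)
  next
    case False
    then have delta1: "delta = 1" using delta by simp
    \<comment> \<open>The zero subspace imposes no condition, so the same formula in dimension 0
      counts all forms of type \<open>eps\<close>.\<close>
    have "vanishing_forms eps {0} = ?Q"
      using quad_forms_polarized polarized_zero by (auto simp: vanishing_forms_def)
    then have cQ: "2 * int (card ?Q) = 2 ^ (2 * n) + eps * 2 ^ n"
      using card_single[of "{0}" 0] by (simp add: totally_isotropic_def)
    have c1: "2 * int (card ?X1) = 2 ^ (2 * n - d) + eps * 2 ^ n"
      and c2: "2 * int (card ?X2) = 2 ^ (2 * n - d) + eps * 2 ^ n"
      using card_single U dims by auto
    have sub: "?X1 \<union> ?X2 \<subseteq> ?Q"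
      by (auto simp: vanishing_forms_def)
    have "int (card (?Q - (?X1 \<union> ?X2))) = int (card ?Q) - int (card (?X1 \<union> ?X2))"
      using sub by (simp add: card_Diff_subset card_mono of_nat_diff)
    moreover have "int (card (?X1 \<union> ?X2)) = int (card ?X1) + int (card ?X2) - int (card (?X1 \<inter> ?X2))"
      using card_Un_Int[of ?X1 ?X2] by simp
    moreover have "2 * Gamma_k n d eps delta = 2 ^ (2 * n) - 2 ^ (2 * n - d)"
    proof -
      have "2 * Gamma_k n d eps delta = 2 ^ Suc (2 * n - d - 1) * (2 ^ d - 1)"
        using delta1 by (simp add: Gamma_k_def)
      also have "Suc (2 * n - d - 1) = 2 * n - d"
        using dims n_pos by simp
      also have "(2::int) ^ (2 * n - d) * (2 ^ d - 1) = 2 ^ (2 * n) - 2 ^ (2 * n - d)"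
        using dims by (simp add: right_diff_distrib flip: power_add)
      finally show ?thesis .
    qed
    moreover have "(?Q - ?X1) \<inter> (?Q - ?X2) = ?Q - (?X1 \<union> ?X2)"
      by blast
    ultimately show ?thesis
      using Delta_set_1[OF U(1,3)] Delta_set_1[OF U(2,4)] cX cQ c1 c2 delta1 dims by simp
  qed
qed

section \<open>Construction of isotropic subspaces with prescribed intersections\<close>

lemma perp_diff_nonempty:
  assumes "vec.subspace W" "card W = 2 ^ k" "k < n"
  obtains v where "v \<in> perp W" "v \<notin> W"
proof -
  have "card (perp W) = 2 ^ (2 * n - k)"
    using assms by (intro card_perp_eq) auto
  moreover have "(2::nat) ^ k < 2 ^ (2 * n - k)"
    using assms(3) by (intro power_strict_increasing) auto
  ultimately have "\<not> perp W \<subseteq> W"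
    using card_mono[of W "perp W"] assms(2) by auto
  then show ?thesis
    using that by blast
qed

lemma totally_isotropic_adjoin:
  assumes "totally_isotropic B W" "v \<in> perp W"
  shows "totally_isotropic B (adjoin W v)"
  using assms
  by (auto simp: totally_isotropic_def adjoin_def perp_def B_add_left B_add_right B_commute[of v])

text \<open>While the dimension is below \<open>n\<close>, the complement is strictly larger than
  the subspace and supplies a vector to adjoin.\<close>

lemma totally_isotropic_exists:
  assumes "k \<le> n"
  shows "\<exists>W. vec.subspace W \<and> totally_isotropic B W \<and> card W = 2 ^ k"
  using assms
proof (induction k)
  case 0
  show ?case
    by (rule exI[of _ "{0}"]) (simp add: totally_isotropic_def)
next
  case (Suc k)
  then obtain W where W: "vec.subspace W" "totally_isotropic B W" "card W = 2 ^ k"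
    by auto
  obtain v where "v \<in> perp W" "v \<notin> W"
    using perp_diff_nonempty[OF W(1,3)] Suc.prems by auto
  then show ?case
    using W by (intro exI[of _ "adjoin W v"]) (simp add: subspace_adjoin totally_isotropic_adjoin card_adjoin)
qed

text \<open>Two isotropic subspaces \<open>H + \<langle>u\<rangle>\<close> and \<open>H + \<langle>v\<rangle>\<close> meeting in the hyperplane \<open>H\<close>
  realise the minimum; whether \<open>B u v\<close> should vanish depends on the case.\<close>

lemma adjacent_isotropic:
  assumes H: "vec.subspace H" "totally_isotropic B H" and uv: "u \<in> perp H" "v \<in> perp H" "v \<notin> adjoin H u"
  shows "adjoin H u \<inter> adjoin H v = H"
    and "B u v = 0 \<Longrightarrow> perp (adjoin H u) \<inter> adjoin H v = adjoin H v"
    and "B u v = 1 \<Longrightarrow> perp (adjoin H u) \<inter> adjoin H v = H"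
proof -
  show "adjoin H u \<inter> adjoin H v = H"
  proof (intro equalityI subsetI)
    fix x assume x: "x \<in> adjoin H u \<inter> adjoin H v"
    show "x \<in> H"
    proof (rule ccontr)
      assume "x \<notin> H"
      then have "x + u \<in> H" "x + v \<in> H"
        using x by (auto simp: mem_adjoin_iff)
      then have "(x + u) + (x + v) \<in> H"
        using H(1) by (simp only: subspace_bit_iff)
      then have "v + u \<in> H"
        by (simp add: ac_simps)
      then show False
        using uv(3) by (simp add: mem_adjoin_iff)
    qed
  qed (simp add: mem_adjoin_iff)
  \<comment> \<open>Both new subspaces lie in \<open>perp H\<close>, so orthogonality to
    \<open>adjoin H u\<close> is tested on \<open>u\<close> alone.\<close>
  have mem: "x \<in> perp (adjoin H u) \<longleftrightarrow> B u x = 0" if "x \<in> perp H" for x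
    using that H(1) by (auto simp: perp_def adjoin_def B_add_left subspace_bit_iff)
  have H_perp: "H \<subseteq> perp H"
    using H(2) by (auto simp: perp_def totally_isotropic_def)
  have Hv: "adjoin H v \<subseteq> perp H"
    using H(2) uv(2) by (auto simp: adjoin_def perp_def totally_isotropic_def B_add_right)
  have u: "B u h = 0" if "h \<in> H" for h
    using uv(1) that by (auto simp: perp_def B_commute[of u])
  show "perp (adjoin H u) \<inter> adjoin H v = adjoin H v" if "B u v = 0"
    using Hv mem that u by (auto simp: adjoin_def B_add_right subset_iff)
  show "perp (adjoin H u) \<inter> adjoin H v = H" if "B u v = 1"
    using Hv mem that u by (auto simp: adjoin_def B_add_right subset_iff)
qed

text \<open>The parameter \<open>b\<close> prescribes \<open>B u v\<close>. For \<open>b = 1\<close>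
  a suitable \<open>v\<close> in \<open>perp H\<close> exists because \<open>u\<close> is outside
  \<open>H\<close>, the double complement of \<open>H\<close>. For \<open>b = 0\<close> it is taken
  from \<open>perp (adjoin H u)\<close> outside \<open>adjoin H u\<close>, which requires
  \<open>d < n\<close>.\<close>

lemma adjacent_isotropic_exist:
  assumes "1 \<le> d" "d \<le> n" and b: "b = 1 \<or> d < n"
  obtains U1 U2 where "vec.subspace U1" "vec.subspace U2" "totally_isotropic B U1" "totally_isotropic B U2"
    "vec.dim U1 = d" "vec.dim U2 = d" "U1 \<noteq> U2" "card (U1 \<inter> U2) = 2 ^ (d - 1)"
    "card (perp U1 \<inter> U2) = (if b = (1::bit) then 2 ^ (d - 1) else 2 ^ d)"
proof -
  have "d - 1 \<le> n"
    using assms(2) by simp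
  then obtain H where H: "vec.subspace H" "totally_isotropic B H" "card H = 2 ^ (d - 1)"
    using totally_isotropic_exists by blast
  obtain u where u: "u \<in> perp H" "u \<notin> H"
    using perp_diff_nonempty[OF H(1,3)] assms(1,2) by (metis Suc_diff_1 Suc_le_lessD less_eq_Suc_le One_nat_def)
  have iso: "totally_isotropic B (adjoin H u)"
    by (rule totally_isotropic_adjoin[OF H(2) u(1)])
  have pow: "2 * 2 ^ (d - 1) = (2::nat) ^ d"
    using assms(1) by (simp flip: power_Suc)
  have card_Hu: "card (adjoin H u) = 2 ^ d"
    using card_adjoin[OF H(1) u(2)] H(3) pow by simp
  have "\<exists>v. v \<in> perp H \<and> v \<notin> adjoin H u \<and> B u v = b"
  proof (cases "b = 1")
    case True
    have "u \<notin> perp (perp H)"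
      using perp_perp[OF H(1)] u(2) by simp
    then obtain v where v: "v \<in> perp H" "B v u = 1"
      by (auto simp: perp_def)
    have "u \<in> adjoin H u"
      using H(1) by (simp add: mem_adjoin_iff subspace_bit_iff)
    then have "v \<notin> adjoin H u"
      using iso v(2) by (auto simp: totally_isotropic_def)
    then show ?thesis
      using v True B_commute[of u v] by auto
  next
    case False
    then have "d < n" "b = 0"
      using b by auto
    then obtain v where v: "v \<in> perp (adjoin H u)" "v \<notin> adjoin H u"
      using perp_diff_nonempty[OF subspace_adjoin[OF H(1)] card_Hu] by blast
    have "v \<in> perp H" "B u v = 0"
      using v(1) H(1) by (auto simp: perp_def mem_adjoin_iff subspace_bit_iff)
    then show ?thesis
      using v(2) \<open>b = 0\<close> by auto
  qed
  then obtain v where v: "v \<in> perp H" "v \<notin> adjoin H u" "B u v = b"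
    by blast
  then have "v \<notin> H"
    by (simp add: mem_adjoin_iff)
  then have card_Hv: "card (adjoin H v) = 2 ^ d"
    using card_adjoin[OF H(1)] H(3) pow by simp
  have dim: "vec.dim U = d" if "vec.subspace U" "card U = 2 ^ d" for U :: "(bit ^ 'm) set"
    using card_subspace[OF that(1)] that(2) by simp
  have "v \<in> adjoin H v"
    using H(1) by (simp add: mem_adjoin_iff subspace_bit_iff)
  show ?thesis
  proof (rule that[of "adjoin H u" "adjoin H v"])
    show "adjoin H u \<noteq> adjoin H v"
      using \<open>v \<in> adjoin H v\<close> v(2) by blast
    show "card (perp (adjoin H u) \<inter> adjoin H v) = (if b = 1 then 2 ^ (d - 1) else 2 ^ d)"
      using adjacent_isotropic(2,3)[OF H(1,2) u(1) v(1,2)] v(3) H(3) card_Hv by auto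
  qed (use H u v iso dim card_Hu card_Hv adjacent_isotropic(1)[OF H(1,2) u(1) v(1,2)] in
        \<open>auto simp: subspace_adjoin totally_isotropic_adjoin\<close>)
qed

end

section \<open>The minimum distance\<close>

definition min_distance_value :: "nat \<Rightarrow> nat \<Rightarrow> int \<Rightarrow> int" where
  "min_distance_value n d eps =
    (if eps = 1 then (if d < n then 2 ^ (2 * n - d - 2) else 2 ^ (n - 1))
     else 2 ^ (n - 2) * (2 ^ (n - d) - 1))"

text \<open>Needed to see that distinct subspaces give distinct codewords. The excluded pair
  \<open>(n, -1)\<close> would give the value 0.\<close>

lemma min_distance_value_pos:
  assumes "d \<le> n" "eps \<in> {1, -1}" "(d, eps) \<noteq> (n, -1)"
  shows "min_distance_value n d eps > 0"
proof -
  have "(1::int) < 2 ^ (n - d)" if "d < n"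
    using that by (intro one_less_power) auto
  then show ?thesis
    using assms by (auto simp: min_distance_value_def)
qed

text \<open>Rewrites all powers in terms of \<open>X\<close> and \<open>f\<close>, so that comparing
  distances becomes polynomial arithmetic without truncated exponents.\<close>

lemma distance_powers:
  assumes "n \<ge> 2" "1 \<le> d" "d \<le> n" "eps \<in> {1, -1}" "(d, eps) \<noteq> (n, -1)"
  defines "X \<equiv> (2::int) ^ (n - d)" and "f \<equiv> (2::int) ^ (d - 1)"
  shows "(2::int) ^ (2 * n - d) + eps * 2 ^ n - (2 ^ (2 * n - 2 * d + j) + eps * 2 ^ (n - d + s))
      = X * X * (2 * f - 2 ^ j) + eps * (X * (2 * f - 2 ^ s))"
    and "2 * min_distance_value n d eps
      = (if eps = 1 then if d < n then X * X * f else 2 * f else X * X * f - X * f)"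
proof -
  have f: "2 * f = 2 ^ d"
    unfolding f_def using assms(2) by (simp flip: power_Suc)
  have XX: "X * X = 2 ^ (2 * n - 2 * d)"
    by (simp only: X_def mult_2[symmetric] right_diff_distrib'[symmetric] flip: power_add)
  have "X * X * (2 * f) = 2 ^ (2 * n - d)" "X * (2 * f) = 2 ^ n"
    unfolding f XX X_def using assms(3) by (simp_all flip: power_add)
  moreover have "X * X * 2 ^ j = 2 ^ (2 * n - 2 * d + j)" "X * 2 ^ s = 2 ^ (n - d + s)"
    by (simp_all only: XX power_add) (simp only: X_def)
  ultimately show "(2::int) ^ (2 * n - d) + eps * 2 ^ n - (2 ^ (2 * n - 2 * d + j) + eps * 2 ^ (n - d + s))
      = X * X * (2 * f - 2 ^ j) + eps * (X * (2 * f - 2 ^ s))"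
    by (simp add: algebra_simps)
  have A: "2 * 2 ^ (2 * n - d - 2) = X * X * f" if "d < n"
  proof -
    have "2 * 2 ^ (2 * n - d - 2) = (2::int) ^ Suc (2 * n - d - 2)"
      by simp
    also have "Suc (2 * n - d - 2) = (2 * n - 2 * d) + (d - 1)"
      using that assms(2) by simp
    finally show ?thesis
      by (simp add: XX f_def power_add)
  qed
  have B: "2 * 2 ^ (n - 2) = X * f"
  proof -
    have "2 * 2 ^ (n - 2) = (2::int) ^ Suc (n - 2)"
      by simp
    also have "Suc (n - 2) = (n - d) + (d - 1)"
      using assms(1-3) by simp
    finally show ?thesis
      by (simp add: X_def f_def power_add)
  qed
  have C: "2 * (2 ^ (n - 2) * (X - 1)) = X * X * f - X * f"
    by (simp only: B right_diff_distrib mult.assoc[symmetric]) (simp add: ac_simps)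
  show "2 * min_distance_value n d eps
      = (if eps = 1 then if d < n then X * X * f else 2 * f else X * X * f - X * f)"
    using A C assms(3) unfolding min_distance_value_def X_def[symmetric] by (auto simp: f_def)
qed

lemma distance_lower_bound:
  assumes "n \<ge> 2" "1 \<le> d" "d \<le> n" "eps \<in> {1, -1}" "(d, eps) \<noteq> (n, -1)"
    and "j < d" "j \<le> s" "s \<le> d" "d = n \<Longrightarrow> s = j"
  shows "2 * min_distance_value n d eps
    \<le> 2 ^ (2 * n - d) + eps * 2 ^ n - (2 ^ (2 * n - 2 * d + j) + eps * 2 ^ (n - d + s))"
proof -
  define X f J S :: int where "X = 2 ^ (n - d)" and "f = 2 ^ (d - 1)" and "J = 2 ^ j" and "S = 2 ^ s"
  have X: "X \<ge> 1"
    by (simp add: X_def)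
  have J: "J \<le> f"
    using assms(6) by (auto simp: J_def f_def intro: power_increasing)
  have JS: "J \<le> S"
    using assms(7) by (simp add: J_def S_def power_increasing)
  have "S \<le> 2 ^ d"
    using assms(8) by (simp add: S_def power_increasing)
  then have S: "S \<le> 2 * f"
    using assms(2) by (simp add: f_def flip: power_Suc)
  have "(if eps = 1 then if d < n then X * X * f else 2 * f else X * X * f - X * f)
      \<le> X * X * (2 * f - J) + eps * (X * (2 * f - S))"
  proof (cases "eps = 1")
    case True
    show ?thesis
    proof (cases "d < n")
      case True
      have "X * X * f \<le> X * X * (2 * f - J)"
        using J X by (intro mult_left_mono) auto
      moreover have "0 \<le> X * (2 * f - S)"
        using S X by simp
      ultimately show ?thesis
        using True \<open>eps = 1\<close> by simp
    next
      case False
      then have "d = n" "S = J" "X = 1"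
        using assms(3,9) by (auto simp: S_def J_def X_def)
      then show ?thesis
        using \<open>eps = 1\<close> J by simp
    qed
  next
    case False
    then have eps: "eps = -1"
      using assms(4) by simp
    have "(X * X - X) * f \<le> (X * X - X) * (2 * f - J)"
      using J X by (intro mult_left_mono) auto
    moreover have "X * (2 * f - S) \<le> X * (2 * f - J)"
      using JS X by (intro mult_left_mono) auto
    ultimately show ?thesis
      using eps by (simp add: left_diff_distrib)
  qed
  then show ?thesis
    using distance_powers(1)[OF assms(1-5), where j = j and s = s] distance_powers(2)[OF assms(1-5)] by (simp only: X_def f_def J_def S_def)
qed

theorem theorem5p22:
  fixes B :: "bit ^ 'm::finite \<Rightarrow> bit ^ 'm \<Rightarrow> bit"
    and n d delta :: nat and eps :: int
  assumes "CARD('m) = 2 * n"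
    and "symplectic_form B"
    and "n \<ge> 2" and "1 \<le> d" and "d \<le> n"
    and "eps \<in> {1, -1}"
    and "(d, eps) \<noteq> (n, -1)"
    and "delta \<in> {0, 1}"
  shows "johnson_min_distance (Gamma_k n d eps delta) (Gamma_code B n d eps delta) =
    (if eps = 1 then (if d < n then 2 ^ (2 * n - d - 2) else 2 ^ (n - 1))
     else 2 ^ (n - 2) * (2 ^ (n - d) - 1))"
proof -
  interpret symplectic_space B n
    by standard fact+
  let ?\<Delta> = "Delta_set B n d eps delta" and ?C = "Gamma_code B n d eps delta"
  let ?dist = "\<lambda>\<Delta>1 \<Delta>2. Gamma_k n d eps delta - int (card (\<Delta>1 \<inter> \<Delta>2))"
  let ?iso = "\<lambda>U. vec.subspace U \<and> vec.dim U = d \<and> totally_isotropic B U"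
  have lower: "min_distance_value n d eps \<le> ?dist (?\<Delta> U1) (?\<Delta> U2)"
    if U1: "?iso U1" and U2: "?iso U2" and "U1 \<noteq> U2" for U1 U2
  proof -
    have sub: "vec.subspace (U1 \<inter> U2)" "vec.subspace (perp U1 \<inter> U2)"
      using U1 U2 subspace_perp vec.subspace_inter by blast+
    define j s where "j = vec.dim (U1 \<inter> U2)" and "s = vec.dim (perp U1 \<inter> U2)"
    have cards: "card (U1 \<inter> U2) = 2 ^ j" "card (perp U1 \<inter> U2) = 2 ^ s" "card U1 = 2 ^ d" "card U2 = 2 ^ d"
      using sub U1 U2 by (simp_all add: card_subspace j_def s_def)
    have iso: "U1 \<subseteq> perp U1"
      using U1 by (auto simp: perp_def totally_isotropic_def)
    have "U1 \<inter> U2 \<noteq> U1"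
      using \<open>U1 \<noteq> U2\<close> cards card_subset_eq[of U2 U1] by auto
    then have "card (U1 \<inter> U2) < card U1"
      by (intro psubset_card_mono) auto
    then have "j < d"
      by (simp add: cards)
    moreover have "card (U1 \<inter> U2) \<le> card (perp U1 \<inter> U2)"
      using iso by (intro card_mono) auto
    then have "j \<le> s"
      by (simp add: cards)
    moreover have "card (perp U1 \<inter> U2) \<le> card U2"
      by (intro card_mono) auto
    then have "s \<le> d"
      by (simp add: cards)
    \<comment> \<open>An isotropic subspace of dimension \<open>n\<close> is its own complement, so
      both intersections coincide.\<close>
    moreover have "s = j" if "d = n"
    proof -
      have "card (perp U1) = card U1"
        using card_perp_eq[of U1 d] U1 cards(3) that by simp
      then have "U1 = perp U1"
        using iso by (metis card_subset_eq finite)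
      then have "card (perp U1 \<inter> U2) = card (U1 \<inter> U2)"
        by simp
      then show ?thesis
        by (simp add: cards)
    qed
    ultimately have "2 * min_distance_value n d eps \<le> 2 * ?dist (?\<Delta> U1) (?\<Delta> U2)"
      using distance_lower_bound[OF assms(3-7)] codeword_distance[OF _ _ _ _ assms(6,8) _ _ assms(4,5) cards(1,2)] U1 U2
      by simp
    then show ?thesis
      by simp
  qed
  have distinct: "?\<Delta> U1 \<noteq> ?\<Delta> U2" if U1: "?iso U1" and U2: "?iso U2" and "U1 \<noteq> U2" for U1 U2
  proof
    assume eq: "?\<Delta> U1 = ?\<Delta> U2"
    have "perp U1 \<inter> U1 = U1"
      using U1 by (auto simp: perp_def totally_isotropic_def)
    \<comment> \<open>The distance formula with \<open>j = s = d\<close> puts a codeword at distance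
      0 from itself, against the positive lower bound for distinct subspaces.\<close>
    then have "2 * ?dist (?\<Delta> U1) (?\<Delta> U1) = 0"
      using codeword_distance[of U1 U1 eps delta d d d] U1 assms(4-8) card_subspace[of U1] by simp
    then show False
      using lower[OF that] eq min_distance_value_pos[OF assms(5-7)] by simp
  qed
  have attained: "\<exists>U1 U2. ?iso U1 \<and> ?iso U2 \<and> U1 \<noteq> U2 \<and> ?dist (?\<Delta> U1) (?\<Delta> U2) = min_distance_value n d eps"
  proof -
    \<comment> \<open>The distance decreases with \<open>s\<close> for \<open>eps = 1\<close>, so
      \<open>s = d\<close> is best when \<open>d < n\<close> permits it. For \<open>eps = -1\<close>
      it increases with \<open>s\<close>, so the least value \<open>s = j = d - 1\<close> is taken;
      for \<open>d = n\<close> this value is forced.\<close>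
    define b :: bit where "b = (if eps = 1 \<and> d < n then 0 else 1)"
    have "b = 1 \<or> d < n"
      by (simp add: b_def)
    then obtain U1 U2 where U: "vec.subspace U1" "vec.subspace U2" "totally_isotropic B U1" "totally_isotropic B U2"
      "vec.dim U1 = d" "vec.dim U2 = d" "U1 \<noteq> U2" "card (U1 \<inter> U2) = 2 ^ (d - 1)"
      "card (perp U1 \<inter> U2) = (if b = 1 then 2 ^ (d - 1) else 2 ^ d)"
      by (rule adjacent_isotropic_exist[OF assms(4,5)])
    define s where "s = (if b = 1 then d - 1 else d)"
    have pow: "(2::int) ^ d = 2 * 2 ^ (d - 1)"
      using assms(4) by (simp flip: power_Suc)
    have "card (perp U1 \<inter> U2) = 2 ^ s"
      using U(9) by (simp add: s_def)
    then have "2 * ?dist (?\<Delta> U1) (?\<Delta> U2)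
        = 2 ^ (2 * n - d) + eps * 2 ^ n - (2 ^ (2 * n - 2 * d + (d - 1)) + eps * 2 ^ (n - d + s))"
      by (intro codeword_distance U assms)
    also have "\<dots> = 2 * min_distance_value n d eps"
      unfolding distance_powers[OF assms(3-7)]
      using assms(4-7) by (auto simp: s_def b_def pow)
    finally have "?dist (?\<Delta> U1) (?\<Delta> U2) = min_distance_value n d eps"
      by simp
    then show ?thesis
      using U by blast
  qed
  have "Min {?dist \<Delta>1 \<Delta>2 | \<Delta>1 \<Delta>2. \<Delta>1 \<in> ?C \<and> \<Delta>2 \<in> ?C \<and> \<Delta>1 \<noteq> \<Delta>2} = min_distance_value n d eps"
  proof (rule Min_eqI)
    show "finite {?dist \<Delta>1 \<Delta>2 | \<Delta>1 \<Delta>2. \<Delta>1 \<in> ?C \<and> \<Delta>2 \<in> ?C \<and> \<Delta>1 \<noteq> \<Delta>2}"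
      by (rule finite_subset[of _ "(\<lambda>(\<Delta>1, \<Delta>2). ?dist \<Delta>1 \<Delta>2) ` UNIV"]) (auto intro: finite_imageI)
    show "min_distance_value n d eps \<le> y"
      if "y \<in> {?dist \<Delta>1 \<Delta>2 | \<Delta>1 \<Delta>2. \<Delta>1 \<in> ?C \<and> \<Delta>2 \<in> ?C \<and> \<Delta>1 \<noteq> \<Delta>2}" for y
    proof -
      from that obtain \<Delta>1 \<Delta>2 where D: "y = ?dist \<Delta>1 \<Delta>2" "\<Delta>1 \<in> ?C" "\<Delta>2 \<in> ?C" "\<Delta>1 \<noteq> \<Delta>2"
        by blast
      then obtain U1 U2 where "?iso U1" "?iso U2" "\<Delta>1 = ?\<Delta> U1" "\<Delta>2 = ?\<Delta> U2"
        unfolding Gamma_code_def by blast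
      then show ?thesis
        using D lower[of U1 U2] by auto
    qed
    obtain U1 U2 where "?iso U1" "?iso U2" "U1 \<noteq> U2" "?dist (?\<Delta> U1) (?\<Delta> U2) = min_distance_value n d eps"
      using attained by blast
    moreover from this have "?\<Delta> U1 \<in> ?C" "?\<Delta> U2 \<in> ?C" "?\<Delta> U1 \<noteq> ?\<Delta> U2"
      using distinct unfolding Gamma_code_def by blast+
    ultimately show "min_distance_value n d eps \<in> {?dist \<Delta>1 \<Delta>2 | \<Delta>1 \<Delta>2. \<Delta>1 \<in> ?C \<and> \<Delta>2 \<in> ?C \<and> \<Delta>1 \<noteq> \<Delta>2}"
      by (metis (mono_tags, lifting) mem_Collect_eq)
  qed
  then show ?thesis
    unfolding johnson_min_distance_def min_distance_value_def .
qed

end
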